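(* If $(u,v)\in D_{3,1}$ with $2\le v\le 3$, then $u\ge 10-3v$.
   Context: For a real algebraic number $\xi$, $H(\xi)$ is the maximum absolute value of the coefficients of its minimal polynomial over $\mathbb{Z}$ (primitive, integer coefficients); for a rational $p/q$ in lowest terms, $H(p/q)=\max(|p|,|q|)$. $\mathbb{A}_3$ is the set of real algebraic numbers of degree exactly 3. $D_{3,1}$ is the set of pairs $(u,v)$ of positive reals for which there exists a constant $c>0$ such that $|\xi-\alpha|\ge cH(\xi)^{-u}H(\alpha)^{-v}$ for all $\xi\in\mathbb{A}_3$ and all $\alpha\in\mathbb{Q}$. *)

theory Defs
  imports "HOL-Analysis.Analysis" "HOL-Computational_Algebra.Computational_Algebra"
begin

text \<open>The sign of the minimal polynomial is fixed by requiring a positive leading coefficient.\<close>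

definition is_int_minpoly :: "real \<Rightarrow> int poly \<Rightarrow> bool" where
  "is_int_minpoly x p \<longleftrightarrow>
     poly (map_poly of_int p) x = 0 \<and> content p = 1 \<and> lead_coeff p > 0 \<and>
     (\<forall>q. q \<noteq> 0 \<and> poly (map_poly of_int q) x = 0 \<longrightarrow> degree p \<le> degree q)"

text \<open>Unspecified if \<open>x\<close> is not algebraic; for algebraic \<open>x\<close> see
  \<open>is_int_minpoly_int_minpoly\<close> below.\<close>

definition int_minpoly :: "real \<Rightarrow> int poly" where
  "int_minpoly x = (THE p. is_int_minpoly x p)"

definition alg_height :: "real \<Rightarrow> int" where
  "alg_height x = Max ((\<lambda>i. \<bar>coeff (int_minpoly x) i\<bar>) ` {..degree (int_minpoly x)})"

definition real_alg_of_degree :: "nat \<Rightarrow> real set" where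
  "real_alg_of_degree n = {x. algebraic x \<and> degree (int_minpoly x) = n}"

definition D31 :: "(real \<times> real) set" where
  "D31 = {(u, v). u > 0 \<and> v > 0 \<and>
     (\<exists>c>0. \<forall>\<xi>\<in>real_alg_of_degree 3. \<forall>\<alpha>\<in>\<rat>.
        \<bar>\<xi> - \<alpha>\<bar> \<ge> c * real_of_int (alg_height \<xi>) powr (- u)
                      * real_of_int (alg_height \<alpha>) powr (- v))}"

lemma eval_int_poly_smult:
  "poly (map_poly of_int (smult c p)) (x::real) = of_int c * poly (map_poly of_int p) x"
  by (simp add: map_poly_smult)

lemma is_int_minpoly_exists:
  assumes "algebraic x"
  shows "\<exists>p. is_int_minpoly x p"
proof -
  obtain p0 where "p0 \<noteq> 0" "poly (map_poly of_int p0) x = 0"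
    using assms by (rule algebraicE')
  then obtain p where p: "p \<noteq> 0" "poly (map_poly of_int p) x = 0"
    and p_min: "\<And>q. q \<noteq> 0 \<Longrightarrow> poly (map_poly of_int q) x = 0 \<Longrightarrow> degree p \<le> degree q"
    using ex_has_least_nat[of "\<lambda>p. p \<noteq> 0 \<and> poly (map_poly of_int p) x = 0" p0 degree] by blast
  define q where "q = smult (sgn (lead_coeff p)) (primitive_part p)"
  have s: "sgn (lead_coeff p) = 1 \<or> sgn (lead_coeff p) = - 1"
    using p(1) by (auto simp: sgn_if)
  have "content p \<noteq> 0" using p(1) by simp
  moreover have "\<bar>content p\<bar> = content p"
    using normalize_content[of p] by (simp only: normalize_int_def)
  ultimately have c: "content p > 0" by linarith
  have eval: "poly (map_poly of_int p) x = of_int (content p) * poly (map_poly of_int (primitive_part p)) x"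
    by (metis content_times_primitive_part eval_int_poly_smult)
  have lc: "lead_coeff p = content p * lead_coeff (primitive_part p)"
    by (metis content_times_primitive_part lead_coeff_smult)
  have deg: "degree q = degree p"
    using s by (auto simp: q_def)
  have "lead_coeff q = sgn (lead_coeff p) * lead_coeff (primitive_part p)"
    by (simp only: q_def lead_coeff_smult)
  also have "sgn (lead_coeff p) = sgn (lead_coeff (primitive_part p))"
    using c by (simp only: lc sgn_mult) simp
  finally have "lead_coeff q = \<bar>lead_coeff (primitive_part p)\<bar>"
    by (simp only: abs_sgn mult.commute)
  moreover have "lead_coeff (primitive_part p) \<noteq> 0"
    using lc p(1) by (metis leading_coeff_0_iff mult_zero_right)
  ultimately have "lead_coeff q > 0" by (simp only: zero_less_abs_iff not_False_eq_True)
  moreover have "poly (map_poly of_int q) x = 0"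
    using p c eval by (auto simp: q_def eval_int_poly_smult)
  moreover have "content q = 1"
    unfolding q_def content_smult using s p(1) by auto
  ultimately have "is_int_minpoly x q"
    using p_min deg by (simp add: is_int_minpoly_def)
  then show ?thesis ..
qed

lemma is_int_minpoly_unique:
  assumes p: "is_int_minpoly x p" and q: "is_int_minpoly x q"
  shows "p = q"
proof -
  have nz: "p \<noteq> 0" "q \<noteq> 0" using p q by (auto simp: is_int_minpoly_def)
  have deg: "degree p = degree q"
    using p q nz by (auto simp: is_int_minpoly_def intro!: antisym)
  define r where "r = smult (lead_coeff q) p - smult (lead_coeff p) q"
  have "map_poly of_int r = (map_poly of_int (smult (lead_coeff q) p)
      - map_poly of_int (smult (lead_coeff p) q) :: real poly)"
    by (rule poly_eqI) (simp add: r_def coeff_map_poly)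
  then have "poly (map_poly of_int r) x = 0"
    using p q by (simp add: eval_int_poly_smult is_int_minpoly_def)
  have "r = 0"
  proof (rule ccontr)
    assume "r \<noteq> 0"
    then have "degree p \<le> degree r"
      using p \<open>poly (map_poly of_int r) x = 0\<close> by (simp add: is_int_minpoly_def)
    moreover have "degree r \<le> degree p"
      unfolding r_def using deg by (intro degree_diff_le) (auto intro: degree_smult_le order_trans)
    ultimately have "lead_coeff r = coeff r (degree p)" by simp
    also have "\<dots> = 0" using deg by (simp add: r_def)
    finally show False using \<open>r \<noteq> 0\<close> by simp
  qed
  then have eq: "smult (lead_coeff q) p = smult (lead_coeff p) q" by (simp add: r_def)
  then have "content (smult (lead_coeff q) p) = content (smult (lead_coeff p) q)" by simp
  then have "lead_coeff p = lead_coeff q"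
    using p q by (simp add: is_int_minpoly_def)
  with eq have "coeff p i = coeff q i" for i
    using nz(2) by (metis coeff_smult leading_coeff_0_iff mult_cancel_left)
  then show "p = q" by (rule poly_eqI)
qed

lemma int_minpoly_eqI: "is_int_minpoly x p \<Longrightarrow> int_minpoly x = p"
  unfolding int_minpoly_def by (blast intro: is_int_minpoly_unique)

lemma is_int_minpoly_int_minpoly: "algebraic x \<Longrightarrow> is_int_minpoly x (int_minpoly x)"
  using is_int_minpoly_exists int_minpoly_eqI by metis

lemma alg_height_rat:
  assumes "coprime a b" and "b > 0"
  shows "alg_height (of_int a / of_int b) = max \<bar>a\<bar> \<bar>b\<bar>"
proof -
  let ?x = "of_int a / of_int b :: real"
  have "is_int_minpoly ?x [:-a, b:]"
    unfolding is_int_minpoly_def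
  proof (intro conjI allI impI)
    show "poly (map_poly of_int [:-a, b:]) ?x = 0"
      using assms(2) by (simp add: map_poly_pCons)
    show "content [:-a, b:] = 1"
      using assms by (simp add: content_def cCons_def)
    show "lead_coeff [:-a, b:] > 0" using assms(2) by simp
    fix q :: "int poly"
    assume q: "q \<noteq> 0 \<and> poly (map_poly of_int q) ?x = 0"
    have "degree q \<noteq> 0"
    proof
      assume "degree q = 0"
      then obtain c where "q = [:c:]" by (rule degree_eq_zeroE)
      with q show False by (auto simp: map_poly_pCons)
    qed
    then show "degree [:-a, b:] \<le> degree q" using assms(2) by simp
  qed
  then have "int_minpoly ?x = [:-a, b:]" by (rule int_minpoly_eqI)
  moreover have "{..Suc 0} = {0, Suc 0}" by auto
  ultimately show ?thesis using assms(2) by (simp add: alg_height_def)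
qed

end

theory Submission
  imports Defs
begin

text \<open>
  It suffices to find cubic numbers \<open>\<xi>\<close> of height \<open>O(b)\<close> and rationals \<open>\<alpha>\<close> of height \<open>O(b\<^sup>3)\<close>,
  with \<open>b\<close> unbounded, such that \<open>\<bar>\<xi> - \<alpha>\<bar> \<le> 1/b\<^bsup>10\<^esup>\<close>. Such a pair comes from a binary cubic form \<open>F\<close> with
  coefficients \<open>O(b)\<close> taking a bounded value at a point of size \<open>b\<^sup>3\<close>. By the syzygy between the
  covariants of \<open>F\<close> this is an extremal case of Hall's conjecture on \<open>x\<^sup>3 - y\<^sup>2\<close>, so, by Davenport's
  bound, no polynomial family exists. As in Danilov's work on Hall's conjecture, a family
  parametrised by units does. Let \<open>\<epsilon> = (1 + \<surd>5)/2\<close>, let a prime denote conjugation in \<open>\<rat>(\<surd>5)\<close>, and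
  for \<open>s = a + b\<epsilon>\<close>, \<open>Z = x + y\<epsilon>\<close> put \<open>F\<^sub>s(x, y) = N(Z) Tr(s\<epsilon>Z) - Tr(s'Z\<^sup>3)\<close>. Then
  \<open>F\<^sub>s = - 8 N(s)\<^sup>5\<close> at \<open>Z = s(\<epsilon>\<^sup>2s\<^sup>2 + \<epsilon>'s'\<^sup>2)\<close>. With \<open>s\<close> a power of \<open>\<epsilon>\<^sup>8\<close>, the form \<open>F\<^sub>s\<close> is
  irreducible because it is so modulo 3.
\<close>

section \<open>The cubic form and its small value\<close>

text \<open>The dehomogenised form \<open>F\<^sub>s(x, 1)\<close>.\<close>

definition danilov_poly :: "int \<Rightarrow> int \<Rightarrow> int poly" where
  "danilov_poly a b = [:- (7 * a + b), 4 * b - 7 * a, a + 13 * b, 2 * b - a:]"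

text \<open>The coordinates with respect to \<open>1, \<epsilon>\<close> of \<open>s(\<epsilon>\<^sup>2s\<^sup>2 + \<epsilon>'s'\<^sup>2) = \<epsilon>\<^sup>2s\<^sup>3 + N(s)\<epsilon>'s'\<close>.\<close>

definition approx_num :: "int \<Rightarrow> int \<Rightarrow> int" where
  "approx_num a b = (a^3 + 3*a*b^2 + b^3) + (3*a^2*b + 3*a*b^2 + 2*b^3)
     + (a^2 + a*b - b^2) * (a + 2*b)"

definition approx_den :: "int \<Rightarrow> int \<Rightarrow> int" where
  "approx_den a b = (a^3 + 3*a*b^2 + b^3) + 2 * (3*a^2*b + 3*a*b^2 + 2*b^3)
     - (a^2 + a*b - b^2) * (a + b)"

text \<open>Write \<open>Z = sW\<close> and \<open>N = N(s)\<close>. Since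
  \<open>\<epsilon>\<epsilon>' = - 1\<close>, one has
  \<open>\<epsilon>W' - W = - 2\<epsilon>'s'\<^sup>2\<close>. With the conjugate relation this turns
  the form into \<open>- 2N\<^sup>3(\<epsilon>'W\<^sup>2 + \<epsilon>W'\<^sup>2)\<close>, and the
  bracket equals \<open>4N\<^sup>2\<close>.\<close>

lemma norm_form_identity:
  fixes a b :: int
  defines "p \<equiv> approx_num a b" and "q \<equiv> approx_den a b"
  shows "(2*b - a) * p^3 + (a + 13*b) * p^2 * q + (4*b - 7*a) * p * q^2 - (7*a + b) * q^3
     = - 8 * (a^2 + a*b - b^2)^5"
  unfolding p_def q_def approx_num_def approx_den_def
  by algebra

section \<open>Minimal polynomials and heights of cubic numbers\<close>

lemma int_poly_linear_rational_root:
  fixes q :: "int poly"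
  assumes "degree q = 1"
  shows "\<exists>x\<in>\<rat>. poly (map_poly of_int q) (x::real) = 0"
proof -
  obtain c d where q: "q = [:c, d:]" and d: "d \<noteq> 0"
    using assms by (metis degree_eq_zeroE degree_pCons_eq_if less_irrefl one_neq_zero pCons_cases pCons_0_0 nat.inject One_nat_def degree_0)
  have "poly (map_poly of_int q) (- of_int c / of_int d :: real) = 0"
    using d by (simp add: q map_poly_pCons)
  moreover have "(- of_int c / of_int d :: real) \<in> \<rat>" by simp
  ultimately show ?thesis by blast
qed

lemma map_poly_of_int_mult:
  "map_poly of_int (p * q) = (map_poly of_int p * map_poly of_int q :: real poly)"
  by (rule poly_eqI) (simp add: coeff_map_poly coeff_mult)

lemma map_poly_of_int_add:
  "map_poly of_int (p + q) = (map_poly of_int p + map_poly of_int q :: real poly)"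
  by (rule poly_eqI) (simp add: coeff_map_poly)

text \<open>A proper factorisation of a cubic contains a linear factor, hence a rational root. So
  the minimal polynomial of \<open>x\<close> has degree 3, and \<open>P\<close> made primitive
  attains this degree.\<close>

lemma cubic_int_minpoly:
  fixes P :: "int poly"
  assumes deg: "degree P = 3" and lc: "lead_coeff P > 0"
    and root: "poly (map_poly of_int P) (x::real) = 0"
    and no_rat: "\<And>y::real. y \<in> \<rat> \<Longrightarrow> poly (map_poly of_int P) y \<noteq> 0"
  shows "algebraic x" and "int_minpoly x = primitive_part P"
proof -
  have P0: "P \<noteq> 0" using deg by auto
  show alg: "algebraic x"
    by (rule algebraicI[of "map_poly of_int P"])
       (use P0 root in \<open>auto simp: coeff_map_poly poly_eq_iff\<close>)
  define m where "m = int_minpoly x"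
  have m: "is_int_minpoly x m"
    unfolding m_def by (rule is_int_minpoly_int_minpoly[OF alg])
  then have m0: "m \<noteq> 0" by (auto simp: is_int_minpoly_def)
  have mroot: "poly (map_poly of_int m) x = 0" using m by (simp add: is_int_minpoly_def)
  have m_min: "degree m \<le> degree q" if "q \<noteq> 0" "poly (map_poly of_int q) x = 0" for q
    using m that by (simp add: is_int_minpoly_def)
  have m_pos: "degree m \<noteq> 0"
  proof
    assume "degree m = 0"
    then obtain k where "m = [:k:]" by (rule degree_eq_zeroE)
    with m0 mroot show False by (auto simp: map_poly_pCons)
  qed
  \<comment> \<open>Pseudo-division stays within integer polynomials at the cost of the factor
    \<open>k\<close>. The remainder vanishes at \<open>x\<close>, so minimality of \<open>m\<close>
    forces it to be zero.\<close>
  obtain Q r where Qr: "pseudo_divmod P m = (Q, r)" by (metis surj_pair)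
  define k where "k = lead_coeff m ^ (Suc (degree P) - degree m)"
  have k0: "k \<noteq> 0" using m0 by (simp add: k_def)
  have div: "smult k P = m * Q + r" and r: "r = 0 \<or> degree r < degree m"
    using pseudo_divmod[OF m0 Qr] by (auto simp: k_def)
  have eval: "of_int k * poly (map_poly of_int P) y
      = poly (map_poly of_int m) y * poly (map_poly of_int Q) y + poly (map_poly of_int r) y" for y :: real
    using arg_cong[OF div, of "\<lambda>p. poly (map_poly of_int p) y"]
    by (simp add: eval_int_poly_smult map_poly_of_int_mult map_poly_of_int_add)
  have "poly (map_poly of_int r) x = 0" using eval[of x] root mroot by simp
  with r m_min[of r] have r0: "r = 0" by linarith
  have Q0: "Q \<noteq> 0" using div r0 k0 P0 by auto
  have "degree (smult k P) = degree m + degree Q"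
    using div r0 m0 Q0 by (simp add: degree_mult_eq)
  then have deg_sum: "degree m + degree Q = 3" using k0 deg by simp
  have no_lin: "degree m \<noteq> 1 \<and> degree Q \<noteq> 1"
  proof (rule ccontr)
    assume "\<not> ?thesis"
    then obtain y :: real where "y \<in> \<rat>"
      "poly (map_poly of_int m) y = 0 \<or> poly (map_poly of_int Q) y = 0"
      using int_poly_linear_rational_root by blast
    then show False using eval[of y] r0 k0 no_rat[of y] by auto
  qed
  have deg_m: "degree m = 3" using deg_sum m_pos no_lin by linarith
  have c0: "content P \<noteq> 0" using P0 by simp
  moreover have "\<bar>content P\<bar> = content P"
    using normalize_content[of P] by (simp only: normalize_int_def)
  ultimately have c: "content P > 0" by linarith
  have Peq: "P = smult (content P) (primitive_part P)" by simp
  have "is_int_minpoly x (primitive_part P)"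
    unfolding is_int_minpoly_def
  proof (intro conjI allI impI)
    show "poly (map_poly of_int (primitive_part P)) x = 0"
      using root c0 by (metis Peq eval_int_poly_smult mult_eq_0_iff of_int_eq_0_iff)
    show "content (primitive_part P) = 1" using P0 by simp
    have "lead_coeff P = content P * lead_coeff (primitive_part P)"
      by (metis Peq lead_coeff_smult)
    then show "lead_coeff (primitive_part P) > 0"
      using lc c by (metis zero_less_mult_pos)
    show "degree (primitive_part P) \<le> degree q"
      if "q \<noteq> 0 \<and> poly (map_poly of_int q) x = 0" for q
      using m_min[of q] that deg deg_m by simp
  qed
  then show "int_minpoly x = primitive_part P" by (rule int_minpoly_eqI)
qed

text \<open>Dividing by the content, a nonzero integer, cannot enlarge a coefficient. Positivity of
  the height serves the monotonicity of \<open>powr\<close> later.\<close>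

lemma cubic_alg_height_le:
  fixes P :: "int poly"
  assumes deg: "degree P = 3" and lc: "lead_coeff P > 0"
    and root: "poly (map_poly of_int P) (x::real) = 0"
    and no_rat: "\<And>y::real. y \<in> \<rat> \<Longrightarrow> poly (map_poly of_int P) y \<noteq> 0"
    and bound: "\<And>i. \<bar>coeff P i\<bar> \<le> B"
  shows "x \<in> real_alg_of_degree 3" and "0 < alg_height x" and "alg_height x \<le> B"
proof -
  have minpoly: "algebraic x" "int_minpoly x = primitive_part P"
    using cubic_int_minpoly[OF deg lc root] no_rat by blast+
  show "x \<in> real_alg_of_degree 3"
    using minpoly deg by (simp add: real_alg_of_degree_def)
  have P0: "P \<noteq> 0" using deg by auto
  have coeff_le: "\<bar>coeff (primitive_part P) i\<bar> \<le> B" for i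
  proof -
    have "coeff P i = content P * coeff (primitive_part P) i"
      by (metis coeff_smult content_times_primitive_part)
    then have "\<bar>coeff P i\<bar> = \<bar>content P\<bar> * \<bar>coeff (primitive_part P) i\<bar>"
      by (simp only: abs_mult)
    moreover have "\<bar>content P\<bar> \<ge> 1" using P0 content_eq_zero_iff[of P] by linarith
    then have "\<bar>coeff (primitive_part P) i\<bar> \<le> \<bar>content P\<bar> * \<bar>coeff (primitive_part P) i\<bar>"
      by (simp add: mult_le_cancel_right1)
    ultimately show ?thesis using bound[of i] by linarith
  qed
  show "alg_height x \<le> B"
    unfolding alg_height_def minpoly(2) using coeff_le by (subst Max_le_iff) auto
  have "0 < \<bar>lead_coeff (primitive_part P)\<bar>"
    using P0 by (simp only: zero_less_abs_iff leading_coeff_0_iff primitive_part_eq_0_iff not_False_eq_True)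
  also have "\<dots> \<le> alg_height x"
    unfolding alg_height_def minpoly(2) by (intro Max_ge) auto
  finally show "0 < alg_height x" .
qed

section \<open>Irreducibility modulo 3\<close>

text \<open>This is the form \<open>F\<^sub>s\<close> reduced modulo 3 for \<open>s\<close>
  congruent to 1; the nine pairs of residues are checked.\<close>

lemma cubic_form_anisotropic_mod_3:
  fixes r t :: int
  assumes "(- (r^3) + r^2 * t - r * t^2 - t^3) mod 3 = 0"
  shows "r mod 3 = 0 \<and> t mod 3 = 0"
proof -
  have "(- (r^3) + r^2 * t - r * t^2 - t^3) mod 3 =
    (- ((r mod 3)^3) + (r mod 3)^2 * (t mod 3) - (r mod 3) * (t mod 3)^2 - (t mod 3)^3) mod 3"
    by (intro mod_diff_cong mod_add_cong mod_mult_cong mod_minus_cong) (simp_all add: power_mod)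
  moreover have "r mod 3 = 0 \<or> r mod 3 = 1 \<or> r mod 3 = 2" "t mod 3 = 0 \<or> t mod 3 = 1 \<or> t mod 3 = 2"
    by presburger+
  ultimately show ?thesis using assms by auto
qed

text \<open>A root \<open>r/t\<close> in lowest terms gives a zero of the homogeneous form, so 3
  would divide both \<open>r\<close> and \<open>t\<close>.\<close>

lemma danilov_poly_no_rational_root:
  fixes a b :: int and y :: real
  assumes "a mod 3 = 1" "b mod 3 = 0" "y \<in> \<rat>"
  shows "poly (map_poly of_int (danilov_poly a b)) y \<noteq> 0"
proof
  assume 0: "poly (map_poly of_int (danilov_poly a b)) y = 0"
  obtain r t :: int where t: "t > 0" "coprime r t" and y: "y = of_int r / of_int t"
    using assms(3) by (rule Rats_cases')
  have "- (7*a + b) + (4*b - 7*a) * y + (a + 13*b) * y^2 + (2*b - a) * y^3 = 0"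
    using 0 by (simp add: danilov_poly_def map_poly_pCons algebra_simps power2_eq_square power3_eq_cube)
  moreover have "real_of_int r = y * real_of_int t" using t(1) by (simp add: y)
  then have "real_of_int ((2*b - a) * r^3 + (a + 13*b) * r^2 * t + (4*b - 7*a) * r * t^2 - (7*a + b) * t^3)
      = of_int t^3 * (- (7*a + b) + (4*b - 7*a) * y + (a + 13*b) * y^2 + (2*b - a) * y^3)"
    by (simp add: algebra_simps power2_eq_square power3_eq_cube)
  ultimately have "real_of_int ((2*b - a) * r^3 + (a + 13*b) * r^2 * t + (4*b - 7*a) * r * t^2 - (7*a + b) * t^3) = 0"
    by (simp only: mult_zero_right)
  then have *: "(2*b - a) * r^3 + (a + 13*b) * r^2 * t + (4*b - 7*a) * r * t^2 - (7*a + b) * t^3 = 0"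
    by (simp only: of_int_eq_0_iff)
  obtain a' where a': "a = 3 * a' + 1" using assms(1) by (metis mult_div_mod_eq)
  obtain b' where b': "b = 3 * b'" using assms(2) by (metis mult_div_mod_eq add.right_neutral)
  \<comment> \<open>The four coefficients are congruent to -1, 1, -1, -1 modulo 3; the bracket on
    the right collects the quotients of the differences by 3.\<close>
  have "- (r^3) + r^2 * t - r * t^2 - t^3 = 3 * (- ((2*b' - a') * r^3 + (a' + 13*b') * r^2 * t
      + (4*b' - 7*a' - 2) * r * t^2 - (7*a' + b' + 2) * t^3))"
    using * unfolding a' b' by algebra
  then have "r mod 3 = 0 \<and> t mod 3 = 0"
    by (intro cubic_form_anisotropic_mod_3) simp
  then have "3 dvd r" "3 dvd t" by auto
  then show False using t(2) by (metis coprime_common_divisor_int zdvd1_eq abs_numeral numeral_eq_one_iff num.distinct(3))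
qed

section \<open>The approximation attached to one unit\<close>

text \<open>\<open>p\<close> and \<open>q\<close> may share a factor; cancelling it can only lower
  the height.\<close>

lemma alg_height_fraction_bounds:
  fixes p q B :: int
  assumes "q > 0" "\<bar>p\<bar> \<le> B" "q \<le> B"
  shows "0 < alg_height (of_int p / of_int q)" and "alg_height (of_int p / of_int q) \<le> B"
proof -
  define g where "g = gcd p q"
  have g: "g > 0" using assms(1) by (simp add: g_def)
  obtain p' q' where pq: "p = p' * g" "q = q' * g" "coprime p' q'"
    using assms(1) gcd_coprime_exists[of p q] unfolding g_def by auto
  have q': "q' > 0" using assms(1) pq(2) g by (simp add: zero_less_mult_iff)
  have "alg_height (of_int p / of_int q) = alg_height (of_int p' / of_int q')"
    using g by (simp add: pq)
  also have "\<dots> = max \<bar>p'\<bar> \<bar>q'\<bar>" by (rule alg_height_rat[OF pq(3) q'])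
  finally have h: "alg_height (of_int p / of_int q) = max \<bar>p'\<bar> \<bar>q'\<bar>" .
  then show "0 < alg_height (of_int p / of_int q)" using q' by simp
  have "\<bar>p'\<bar> * 1 \<le> \<bar>p'\<bar> * g" "q' * 1 \<le> q' * g"
    using g q' by (intro mult_left_mono; simp)+
  then have "\<bar>p'\<bar> \<le> \<bar>p\<bar>" "q' \<le> q" using g by (simp_all add: pq abs_mult)
  then show "alg_height (of_int p / of_int q) \<le> B" using h q' assms by simp
qed

text \<open>To the right of \<open>x\<close> the function \<open>f z - M * z\<close> is
  nondecreasing, so \<open>f\<close> has reached 0 by the point \<open>x - f x / M\<close>.\<close>

lemma root_right_of_point:
  fixes f f' :: "real \<Rightarrow> real"
  assumes deriv: "\<And>z. (f has_real_derivative f' z) (at z)"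
    and slope: "\<And>z. z \<ge> x \<Longrightarrow> f' z \<ge> M" and M: "M > 0" and neg: "f x \<le> 0"
  shows "\<exists>\<xi>. f \<xi> = 0 \<and> x \<le> \<xi> \<and> \<xi> - x \<le> - f x / M"
proof -
  define y where "y = x - f x / M"
  have xy: "x \<le> y" using neg M by (simp add: y_def divide_nonpos_pos)
  have "f x - M * x \<le> f y - M * y"
  proof (rule DERIV_nonneg_imp_nondecreasing[OF xy])
    fix z assume "x \<le> z" "z \<le> y"
    then show "\<exists>D. ((\<lambda>z. f z - M * z) has_real_derivative D) (at z) \<and> 0 \<le> D"
      by (intro exI[of _ "f' z - M"]) (auto intro!: derivative_eq_intros deriv simp: slope)
  qed
  moreover have "M * y = M * x - f x" using M by (simp add: y_def field_simps)
  ultimately have "f y \<ge> 0" by linarith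
  then obtain \<xi> where "x \<le> \<xi>" "\<xi> \<le> y" "f \<xi> = 0"
    using IVT[of f x 0 y] neg xy DERIV_isCont[OF deriv] by blast
  then show ?thesis by (intro exI[of _ \<xi>]) (simp add: y_def)
qed

text \<open>The cubic takes the value \<open>- 8 / q^3\<close> at \<open>p / q\<close>, of size at
  most \<open>8 / b^9\<close>, and has slope at least \<open>10 * b\<close> to the right of
  it.\<close>

lemma good_approximation:
  fixes a b :: int
  assumes N: "a^2 + a*b - b^2 = 1" and a: "0 < a" "a \<le> b" and mod3: "a mod 3 = 1" "b mod 3 = 0"
  shows "\<exists>\<xi>\<in>real_alg_of_degree 3. \<exists>\<alpha>\<in>\<rat>. 0 < alg_height \<xi> \<and> alg_height \<xi> \<le> 14 * b \<and>
      0 < alg_height \<alpha> \<and> alg_height \<alpha> \<le> 21 * b^3 \<and> \<bar>\<xi> - \<alpha>\<bar> \<le> 1 / real_of_int b ^ 10"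
proof -
  define p where "p = approx_num a b"
  define q where "q = approx_den a b"
  define A where "A = real_of_int a"
  define B where "B = real_of_int b"
  have b: "0 < b" using a by simp
  have AB: "0 < A" "A \<le> B" "0 < B" using a b by (simp_all add: A_def B_def)
  have p: "p = a^3 + 6*(a*b^2) + 3*b^3 + 3*(a^2*b) + a + 2*b"
    and q: "q = a^3 + 9*(a*b^2) + 5*b^3 + 6*(a^2*b) - a - b"
    unfolding p_def q_def approx_num_def approx_den_def N by simp_all
  have cubes: "a \<le> a^3" "b \<le> b^3" "a^3 \<le> b^3" "a * b^2 \<le> b^3" "a^2 * b \<le> b^3" "0 < a * b^2" "0 < a^2 * b"
  proof -
    show "a \<le> a^3" "b \<le> b^3" using a b self_le_power[of a 3] self_le_power[of b 3] by simp_all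
    show "a^3 \<le> b^3" using a by (intro power_mono) auto
    show "a * b^2 \<le> b^3" using a mult_right_mono[of a b "b^2"] by (simp add: power3_eq_cube power2_eq_square)
    show "a^2 * b \<le> b^3" using a mult_right_mono[OF power_mono[of a b 2], of b]
      by (simp add: power3_eq_cube power2_eq_square)
    show "0 < a * b^2" "0 < a^2 * b" using a by simp_all
  qed
  \<comment> \<open>The constant 21 is the sum 1 + 9 + 5 + 6 of the positive coefficients of
    \<open>q\<close>.\<close>
  have p0: "0 < p" and pB: "p \<le> 21 * b^3" and q_ge: "b^3 \<le> q" and qB: "q \<le> 21 * b^3"
    using cubes a b unfolding p q by linarith+
  \<comment> \<open>This yields \<open>\<alpha> \<ge> 1/2\<close>, from where on the derivative is
    at least \<open>(A + 13*B) + (4*B - 7*A) \<ge> 11*B\<close>.\<close>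
  have "2 * p - q = a^3 + 3*(a*b^2) + b^3 + 3*a + 5*b" by (simp add: p q)
  moreover have "0 \<le> a^3 + 3*(a*b^2) + b^3 + 3*a + 5*b" using a b by simp
  ultimately have pq: "q \<le> 2 * p" by linarith
  have q0: "0 < q" using q_ge b by (meson zero_less_power less_le_trans)
  define \<alpha> :: real where "\<alpha> = of_int p / of_int q"
  have \<alpha>_ge: "\<alpha> \<ge> 1/2" using pq q0 by (simp add: \<alpha>_def field_simps)
  define f where "f = (\<lambda>z. (2*B - A) * z^3 + (A + 13*B) * z^2 + (4*B - 7*A) * z - (7*A + B))"
  define f' where "f' = (\<lambda>z. 3 * (2*B - A) * z^2 + 2 * (A + 13*B) * z + (4*B - 7*A))"
  have f_poly: "poly (map_poly of_int (danilov_poly a b)) z = f z" for z :: real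
    by (simp add: danilov_poly_def f_def A_def B_def map_poly_pCons algebra_simps
        power2_eq_square power3_eq_cube)
  have deriv: "(f has_real_derivative f' z) (at z)" for z
    unfolding f_def f'_def by (auto intro!: derivative_eq_intros simp: algebra_simps)
  have slope: "f' z \<ge> 10 * B" if "z \<ge> \<alpha>" for z
  proof -
    have "0 \<le> 3 * (2*B - A) * z^2" using AB by simp
    moreover have "2 * (A + 13*B) * (1/2) \<le> 2 * (A + 13*B) * z"
      using AB that \<alpha>_ge by (intro mult_left_mono) auto
    ultimately show ?thesis using AB unfolding f'_def by argo
  qed
  have "real_of_int q ^ 3 * f \<alpha> = real_of_int ((2*b - a) * p^3 + (a + 13*b) * p^2 * q + (4*b - 7*a) * p * q^2 - (7*a + b) * q^3)"
    using q0 by (simp add: f_def \<alpha>_def A_def B_def field_simps power2_eq_square power3_eq_cube)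
  also have "\<dots> = real_of_int (- 8)"
    unfolding p_def q_def norm_form_identity N by simp
  finally have f\<alpha>: "f \<alpha> = - 8 / real_of_int q ^ 3" using q0 by (simp add: field_simps)
  then have "f \<alpha> \<le> 0" using q0 by simp
  then obtain \<xi> where \<xi>: "f \<xi> = 0" "\<alpha> \<le> \<xi>" "\<xi> - \<alpha> \<le> - f \<alpha> / (10 * B)"
    using root_right_of_point[of f f' \<alpha> "10 * B"] deriv slope AB by auto
  \<comment> \<open>Nine powers of \<open>B\<close> come from \<open>q^3\<close>, the tenth from the
    slope.\<close>
  have "real_of_int q \<ge> B^3" unfolding B_def using q_ge by (metis of_int_le_iff of_int_power)
  then have "(B^3)^3 \<le> real_of_int q ^ 3" using AB by (intro power_mono) auto
  then have "B^9 \<le> real_of_int q ^ 3" by (simp flip: power_mult)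
  then have "- f \<alpha> / (10 * B) \<le> 8 / B^9 / (10 * B)"
    unfolding f\<alpha> using AB q0 by (intro divide_right_mono) (auto intro!: divide_left_mono)
  also have "\<dots> \<le> 1 / B^10" using AB by (simp add: field_simps eval_nat_numeral)
  finally have close: "\<bar>\<xi> - \<alpha>\<bar> \<le> 1 / real_of_int b ^ 10"
    using \<xi> by (simp add: B_def)
  have deg: "degree (danilov_poly a b) = 3" and lc: "lead_coeff (danilov_poly a b) > 0"
    using a b by (simp_all add: danilov_poly_def)
  \<comment> \<open>The largest coefficient is \<open>a + 13 * b\<close>, at most
    \<open>14 * b\<close>.\<close>
  have coeffs: "\<bar>coeff (danilov_poly a b) i\<bar> \<le> 14 * b" for i
    using a b by (auto simp: danilov_poly_def coeff_pCons split: nat.split)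
  have root: "poly (map_poly of_int (danilov_poly a b)) \<xi> = 0" using \<xi>(1) by (simp only: f_poly)
  have height_\<xi>: "\<xi> \<in> real_alg_of_degree 3" "0 < alg_height \<xi>" "alg_height \<xi> \<le> 14 * b"
    using cubic_alg_height_le[OF deg lc root danilov_poly_no_rational_root coeffs] mod3 by blast+
  have "\<bar>p\<bar> \<le> 21 * b^3" using p0 pB by simp
  note height_\<alpha> = alg_height_fraction_bounds[OF q0 this qB, folded \<alpha>_def]
  have "\<alpha> \<in> \<rat>" by (simp add: \<alpha>_def)
  with height_\<xi> height_\<alpha> close show ?thesis by blast
qed

section \<open>The family of units and the comparison of exponents\<close>

text \<open>\<open>\<epsilon>\<^sup>8\<close> has norm 1 and is the least positive power of
  \<epsilon> congruent to 1 modulo 3, so multiplying by it preserves the norm and both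
  congruences.\<close>

lemma unit_pairs_unbounded:
  "\<exists>a b::int. a^2 + a*b - b^2 = 1 \<and> 0 < a \<and> a \<le> b \<and> a mod 3 = 1 \<and> b mod 3 = 0 \<and> int n \<le> b"
proof (induction n)
  case 0
  show ?case by (intro exI[of _ 13] exI[of _ 21]) simp
next
  case (Suc n)
  then obtain a b :: int where ab: "a^2 + a*b - b^2 = 1" "0 < a" "a \<le> b"
    "a mod 3 = 1" "b mod 3 = 0" "int n \<le> b" by (elim exE conjE) (rule that)
  \<comment> \<open>Multiplication of \<open>a + b\<epsilon>\<close> by \<open>\<epsilon>\<^sup>8 = 13 + 21\<epsilon>\<close>.\<close>
  show ?case
  proof (intro exI conjI)
    show "(13*a + 21*b)^2 + (13*a + 21*b) * (21*a + 34*b) - (21*a + 34*b)^2 = 1"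
      using ab(1) by algebra
    show "(13*a + 21*b) mod 3 = 1" "(21*a + 34*b) mod 3 = 0" using ab(4,5) by presburger+
  qed (use ab in auto)
qed

theorem theorem3:
  fixes u v :: real
  assumes "(u, v) \<in> D31" and "2 \<le> v" and "v \<le> 3"
  shows "u \<ge> 10 - 3 * v"
proof (rule ccontr)
  assume "\<not> u \<ge> 10 - 3 * v"
  \<comment> \<open>The pairs found would give \<open>K * B powr e \<le> 1\<close> for unbounded
    \<open>B\<close>.\<close>
  define e where "e = 10 - u - 3 * v"
  have e: "e > 0" using \<open>\<not> u \<ge> 10 - 3 * v\<close> by (simp add: e_def)
  obtain c where uv: "u > 0" "v > 0" and c: "c > 0"
    and bound: "\<And>\<xi> \<alpha>. \<xi> \<in> real_alg_of_degree 3 \<Longrightarrow> \<alpha> \<in> \<rat> \<Longrightarrow>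
       c * real_of_int (alg_height \<xi>) powr (- u) * real_of_int (alg_height \<alpha>) powr (- v) \<le> \<bar>\<xi> - \<alpha>\<bar>"
    using assms(1) unfolding D31_def by auto
  define K where "K = c * 14 powr (- u) * 21 powr (- v)"
  have K: "K > 0" using c by (simp add: K_def)
  \<comment> \<open>From \<open>n\<close> on, \<open>K * B powr e\<close> exceeds 1; the added 1
    makes this strict.\<close>
  define n where "n = nat \<lceil>(1 / K) powr (1 / e)\<rceil> + 1"
  obtain a b :: int where ab: "a^2 + a*b - b^2 = 1" "0 < a" "a \<le> b"
    "a mod 3 = 1" "b mod 3 = 0" "int n \<le> b" using unit_pairs_unbounded[of n] by (elim exE conjE) (rule that)
  define B where "B = real_of_int b"
  have B: "B > 0" using ab by (simp add: B_def)
  obtain \<xi> \<alpha> where \<xi>: "\<xi> \<in> real_alg_of_degree 3" "0 < alg_height \<xi>" "alg_height \<xi> \<le> 14 * b"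
    and \<alpha>: "\<alpha> \<in> \<rat>" "0 < alg_height \<alpha>" "alg_height \<alpha> \<le> 21 * b^3"
    and close: "\<bar>\<xi> - \<alpha>\<bar> \<le> 1 / B ^ 10"
    using good_approximation[OF ab(1-5)] unfolding B_def by blast
  have h\<xi>: "real_of_int (alg_height \<xi>) \<le> 14 * B" using \<xi>(3) unfolding B_def by linarith
  have "real_of_int (alg_height \<alpha>) \<le> real_of_int (21 * b^3)" using \<alpha>(3) by (simp only: of_int_le_iff)
  then have h\<alpha>: "real_of_int (alg_height \<alpha>) \<le> 21 * B^3" by (simp add: B_def)
  have "K * B powr (- u - 3 * v) = c * (14 * B) powr (- u) * (21 * B^3) powr (- v)"
  proof -
    have "B^3 = B powr 3" using B by (simp add: powr_numeral)
    then have "(B^3) powr (- v) = B powr (- 3 * v)"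
      by (simp only: powr_powr) simp
    then have "(21 * B^3) powr (- v) = 21 powr (- v) * B powr (- 3 * v)"
      using B by (simp add: powr_mult)
    moreover have "(14 * B) powr (- u) = 14 powr (- u) * B powr (- u)"
      using B by (simp add: powr_mult)
    moreover have "B powr (- u - 3 * v) = B powr (- u) * B powr (- 3 * v)"
      by (simp flip: powr_add)
    ultimately show ?thesis by (simp add: K_def)
  qed
  \<comment> \<open>The exponents are negative, so upper bounds on the heights bound the powers from
    below.\<close>
  also have "\<dots> \<le> c * real_of_int (alg_height \<xi>) powr (- u) * real_of_int (alg_height \<alpha>) powr (- v)"
    using c uv \<xi>(2) \<alpha>(2) h\<xi> h\<alpha> by (intro mult_mono powr_mono2') auto
  also have "\<dots> \<le> \<bar>\<xi> - \<alpha>\<bar>" by (rule bound[OF \<xi>(1) \<alpha>(1)])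
  also note close
  also have "1 / B ^ 10 = B powr (- 10)" using B by (simp add: powr_minus powr_numeral field_simps)
  finally have "K * B powr (- u - 3 * v) * B powr 10 \<le> B powr (- 10) * B powr 10"
    by (rule mult_right_mono) simp
  then have "K * B powr (- u - 3 * v + 10) \<le> 1"
    using B by (simp only: mult.assoc powr_add[symmetric]) simp
  then have "K * B powr e \<le> 1" by (simp add: e_def algebra_simps)
  then have "B powr e \<le> 1 / K" using K by (simp add: field_simps)
  then have "(B powr e) powr (1 / e) \<le> (1 / K) powr (1 / e)" using e by (intro powr_mono2) auto
  then have "B \<le> (1 / K) powr (1 / e)" using e B by (simp add: powr_powr)
  also have "\<dots> < real n" unfolding n_def by linarith
  also have "\<dots> \<le> B" unfolding B_def using ab(6) by linarith
  finally show False by simp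
qed

end
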